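(* For $N\in\mathbb{N}$ let $\mathbb{S}^1_+(N)\subset\mathbb{R}^2$ be the upper semicircle of radius $\sqrt N$ centered at the origin, and let $S_N=\mathbb{S}^1_+(N)\cap\mathbb{Z}^2$. Assume that for some $\gamma\in(\frac12,1)$ there is a constant $C(\gamma)$ such that for every $N\in\mathbb{N}$ every arc in $\mathbb{S}^1_+(N)$ of length $N^{\gamma/2}$ contains at most $C(\gamma)$ lattice points (points of $\mathbb{Z}^2$). Let $\sigma$ be a (finite, positive) measure on $\mathbb{T}^2$ such that, for some $\beta>0$, $|\widehat\sigma(\xi)|\lesssim(1+|\xi|)^{-\beta}$ for all $\xi\in\mathbb{Z}^2$. Then for every $N\in\mathbb{N}$ and all complex coefficients $a=(a_{\mathbf n})_{\mathbf n\in S_N}$, $$\int_{\mathbb{T}^2}\Big|\sum_{\mathbf n\in S_N}a_{\mathbf n}\,e(\mathbf n\cdot x)\Big|^4d\sigma(x)\lesssim\|a\|_{\ell^2(S_N)}^4,$$ with the implicit constant independent of $N$ (and of $a$).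
   Context: $e(t)=e^{2\pi it}$; $\widehat\sigma(\xi)=\int_{\mathbb{T}^2}e(-\xi\cdot x)\,d\sigma(x)$. The implicit constant may depend on $\sigma$, $\beta$, $\gamma$ and $C(\gamma)$. *)

theory Defs
  imports "HOL-Analysis.Analysis"
begin

definition e :: "real \<Rightarrow> complex" where
  "e t = exp (2 * of_real pi * \<i> * of_real t)"

definition lattice2 :: "(real \<times> real) set" where
  "lattice2 = \<int> \<times> \<int>"

text \<open>
  The torus \<open>\<real>\<^sup>2 / \<int>\<^sup>2\<close> as a measurable space, represented by its fundamental domain
  \<open>[0,1) \<times> [0,1)\<close>. A Borel measure on the torus is a measure with these measurable sets; the
  functions integrated below are \<open>\<int>\<^sup>2\<close>-periodic.
\<close>
definition torus2 :: "(real \<times> real) measure" where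
  "torus2 = restrict_space borel ({0..<1} \<times> {0..<1})"

definition fourier_coeff :: "(real \<times> real) measure \<Rightarrow> real \<times> real \<Rightarrow> complex" where
  "fourier_coeff \<sigma> \<xi> = (LINT x|\<sigma>. e (- \<xi> \<bullet> x))"

text \<open>The norm on \<open>real \<times> real\<close> is Euclidean. Both endpoints of the semicircle are included.\<close>
definition upper_semicircle :: "nat \<Rightarrow> (real \<times> real) set" where
  "upper_semicircle N = {x. norm x = sqrt (real N) \<and> snd x \<ge> 0}"

definition S :: "nat \<Rightarrow> (real \<times> real) set" where
  "S N = upper_semicircle N \<inter> lattice2"

text \<open>\<open>A\<close> is a (closed) arc of length \<open>L\<close> in the upper semicircle of radius \<open>sqrt N\<close>.\<close>
definition is_arc :: "nat \<Rightarrow> real \<Rightarrow> (real \<times> real) set \<Rightarrow> bool" where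
  "is_arc N L A \<longleftrightarrow>
     (\<exists>\<theta>\<^sub>1 \<theta>\<^sub>2. 0 \<le> \<theta>\<^sub>1 \<and> \<theta>\<^sub>1 \<le> \<theta>\<^sub>2 \<and> \<theta>\<^sub>2 \<le> pi \<and>
        A = (\<lambda>\<theta>. sqrt (real N) *\<^sub>R (cos \<theta>, sin \<theta>)) ` {\<theta>\<^sub>1..\<theta>\<^sub>2} \<and>
        L = sqrt (real N) * (\<theta>\<^sub>2 - \<theta>\<^sub>1))"

end

theory Submission
  imports Defs "HOL-Computational_Algebra.Primes"
begin

text \<open>
  Expanding the fourth power turns the left side into a sum over pairs \<open>p, q\<close> in \<open>S N \<times> S N\<close> of
  \<open>c p \<cdot> cnj (c q)\<close>, where \<open>c p = a p\<^sub>1 \<cdot> a p\<^sub>2\<close>, times the Fourier coefficient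
  of \<open>\<sigma>\<close> at \<open>(q\<^sub>1 + q\<^sub>2) - (p\<^sub>1 + p\<^sub>2)\<close>, so by Schur's test it suffices to bound \<open>\<Sum>q. (1 + |(p\<^sub>1 + p\<^sub>2) - (q\<^sub>1 + q\<^sub>2)|) powr -\<beta>\<close> uniformly in \<open>p\<close> and \<open>N\<close>.
  With \<open>R = N powr \<delta>\<close>, the pairs whose sums are more than \<open>R\<close> apart contribute \<open>O(1)\<close>, since \<open>S N\<close> has
  only \<open>O(N powr \<epsilon>)\<close> points. If the sums are within \<open>R\<close>, then \<open>q\<^sub>1\<close> and \<open>q\<^sub>2\<close> each lie within
  \<open>O(sqrt (R \<cdot> sqrt N))\<close> of \<open>p\<^sub>1\<close> or \<open>p\<^sub>2\<close>. The exponent \<open>1/4 + \<delta>/2\<close> of this distance is below \<open>\<gamma>/2\<close> for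
  small \<open>\<delta>\<close> because \<open>\<gamma> > 1/2\<close>, so the arc hypothesis bounds the number of such \<open>q\<close>.
\<close>

lemma card_le_fibres:
  assumes "finite B" and "f ` A \<subseteq> B" and "\<And>b. b \<in> B \<Longrightarrow> finite {a \<in> A. f a = b} \<and> card {a \<in> A. f a = b} \<le> c"
  shows "card A \<le> c * card B"
proof -
  have "A = (\<Union>b\<in>B. {a \<in> A. f a = b})" using assms(2) by auto
  then have "card A \<le> (\<Sum>b\<in>B. card {a \<in> A. f a = b})"
    using card_UN_le[OF assms(1), of "\<lambda>b. {a \<in> A. f a = b}"] by simp
  also have "\<dots> \<le> (\<Sum>b\<in>B. c)" by (intro sum_mono) (use assms(3) in auto)
  finally show ?thesis by (simp add: mult.commute)
qed

subsection \<open>The divisor bound\<close>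

text \<open>Each divisor splits as \<open>p ^ j * d\<close> with \<open>j \<le> k\<close> and
  \<open>d dvd m\<close>, so the pairs \<open>(j, d)\<close> cover all divisors.\<close>

lemma card_divisors_prime_power_mult_le:
  fixes p k m :: nat
  assumes "prime p" and "m > 0"
  shows "card {d. d dvd p ^ k * m} \<le> (k + 1) * card {d. d dvd m}"
proof -
  have "{d. d dvd p ^ k * m} \<subseteq> (\<lambda>(j, d). p ^ j * d) ` ({..k} \<times> {d. d dvd m})"
  proof
    fix d assume "d \<in> {d. d dvd p ^ k * m}"
    then obtain b c where "d = b * c" "b dvd p ^ k" "c dvd m"
      using division_decomp[of d "p ^ k" m] by auto
    moreover from this obtain j where "j \<le> k" "b = p ^ j"
      using divides_primepow_nat[OF assms(1)] by auto
    ultimately show "d \<in> (\<lambda>(j, d). p ^ j * d) ` ({..k} \<times> {d. d dvd m})" by force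
  qed
  then have "card {d. d dvd p ^ k * m} \<le> card ({..k} \<times> {d. d dvd m})"
    using assms(2) by (intro surj_card_le) auto
  then show ?thesis by (simp add: card_cartesian_product)
qed

text \<open>Serves the small primes in the divisor bound: there \<open>p powr \<epsilon>\<close> may
  be below 2, and the constant \<open>D\<close> pays for the loss.\<close>

lemma Suc_le_const_mult_two_powr:
  fixes \<epsilon> :: real
  assumes "\<epsilon> > 0"
  obtains D :: real where "D \<ge> 1" and "\<And>k::nat. real k + 1 \<le> D * 2 powr (k * \<epsilon>)"
proof
  \<comment> \<open>Makes \<open>D * (\<epsilon> * ln 2) \<ge> 1\<close>, so that
    \<open>1 + t \<le> exp t\<close> at \<open>t = k * \<epsilon> * ln 2\<close> suffices.\<close>
  define D where "D = max 1 (1 / (\<epsilon> * ln 2))"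
  show "D \<ge> 1" by (simp add: D_def)
  show "real k + 1 \<le> D * 2 powr (k * \<epsilon>)" for k :: nat
  proof -
    have "D * (\<epsilon> * ln 2) \<ge> 1 / (\<epsilon> * ln 2) * (\<epsilon> * ln 2)"
      using assms by (intro mult_right_mono) (auto simp: D_def)
    then have "1 \<le> D * (\<epsilon> * ln 2)" using assms by simp
    then have "real k * 1 \<le> real k * (D * (\<epsilon> * ln 2))" by (intro mult_left_mono) auto
    then have "real k + 1 \<le> D * (1 + k * \<epsilon> * ln 2)"
      using \<open>D \<ge> 1\<close> by (simp add: algebra_simps)
    also have "\<dots> \<le> D * exp (k * \<epsilon> * ln 2)"
      using \<open>D \<ge> 1\<close> by (intro mult_left_mono exp_ge_add_one_self) auto
    finally show ?thesis by (simp add: powr_def)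
  qed
qed

text \<open>Splitting off the full power \<open>p ^ k\<close> of a prime costs a factor of at most
  \<open>k + 1\<close>. For large \<open>p\<close> this is at most
  \<open>p powr (k * \<epsilon>)\<close>; for each of the boundedly many small primes a further
  factor \<open>D\<close> is lost.\<close>

lemma divisor_bound:
  fixes \<epsilon> :: real
  assumes "\<epsilon> > 0"
  obtains C :: real where "\<And>n::nat. n > 0 \<Longrightarrow> real (card {d. d dvd n}) \<le> C * real n powr \<epsilon>"
proof -
  obtain D where D: "D \<ge> 1" "\<And>k::nat. real k + 1 \<le> D * 2 powr (k * \<epsilon>)"
    using Suc_le_const_mult_two_powr[OF assms] by blast
  \<comment> \<open>Threshold from which \<open>p powr \<epsilon> \<ge> 2\<close>, hence
    \<open>p powr (k * \<epsilon>) \<ge> 2 ^ k \<ge> k + 1\<close>.\<close>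
  define P where "P = nat \<lceil>2 powr (1 / \<epsilon>)\<rceil>"
  have large: "real k + 1 \<le> real p powr (k * \<epsilon>)" if "p \<ge> P" for k p :: nat
  proof -
    have "2 powr (1 / \<epsilon>) \<le> real p" using that by (simp add: P_def nat_le_iff ceiling_le_iff)
    then have "(2 powr (1 / \<epsilon>)) powr (k * \<epsilon>) \<le> real p powr (k * \<epsilon>)"
      using assms by (intro powr_mono2) auto
    moreover have "(2 powr (1 / \<epsilon>)) powr (k * \<epsilon>) = 2 ^ k"
      using assms by (simp add: powr_powr powr_realpow)
    moreover have "real k + 1 \<le> 2 ^ k"
      using Bernoulli_inequality[of "1::real" k] by simp
    ultimately show ?thesis by simp
  qed
  \<comment> \<open>The exponent of \<open>D\<close> counts only the small prime factors of
    \<open>n\<close>: removing the full power of one prime per induction step costs one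
    \<open>D\<close> if that prime is small and none otherwise.\<close>
  have main: "real (card {d. d dvd n}) \<le> D ^ card {p \<in> prime_factors n. p < P} * real n powr \<epsilon>"
    if "n > 0" for n :: nat
    using that
  proof (induction n rule: less_induct)
    case (less n)
    show ?case
    proof (cases "n = 1")
      case False
      then obtain p where p: "prime p" "p dvd n" using prime_factor_nat by blast
      define k where "k = multiplicity p n"
      obtain m where m: "n = p ^ k * m" "\<not> p dvd m"
        using multiplicity_decompose'[of n p] less.prems p unfolding k_def
        by (metis bot_nat_0.not_eq_extremum not_prime_unit)
      have "m > 0" using m less.prems by (auto intro: gr0I)
      have "k > 0" using p m(1) m(2) by (cases k) auto
      have "m < n" using m(1) \<open>m > 0\<close> \<open>k > 0\<close> one_less_power[OF prime_gt_1_nat[OF p(1)]] by simp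
      have pf: "prime_factors n = insert p (prime_factors m)"
        using less.prems \<open>m > 0\<close> \<open>k > 0\<close> p(1) unfolding m(1)
        by (auto simp: in_prime_factors_iff prime_dvd_mult_iff prime_dvd_power_iff primes_dvd_imp_eq)
      have pnot: "p \<notin> prime_factors m" using m(2) by auto
      define c where "c = card {p \<in> prime_factors m. p < P}"
      have cn: "card {p \<in> prime_factors n. p < P} = (if p < P then Suc c else c)"
      proof (cases "p < P")
        case True
        then have "{p \<in> prime_factors n. p < P} = insert p {p \<in> prime_factors m. p < P}" using pf by auto
        then show ?thesis using pnot True by (simp add: c_def)
      next
        case False
        then have "{p \<in> prime_factors n. p < P} = {p \<in> prime_factors m. p < P}" using pf by auto
        then show ?thesis using False by (simp add: c_def)
      qed
      have step: "(real k + 1) * D ^ c \<le> D ^ (if p < P then Suc c else c) * real p powr (k * \<epsilon>)"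
      proof (cases "p < P")
        case True
        have "2 powr (k * \<epsilon>) \<le> real p powr (k * \<epsilon>)"
          using assms prime_ge_2_nat[OF p(1)] by (intro powr_mono2) auto
        then have "D * 2 powr (k * \<epsilon>) \<le> D * real p powr (k * \<epsilon>)" using D(1) by simp
        then have "real k + 1 \<le> D * real p powr (k * \<epsilon>)" using D(2)[of k] by linarith
        then show ?thesis using True D(1) mult_right_mono[of "real k + 1" _ "D ^ c"]
          by (fastforce simp: algebra_simps)
      next
        case False
        then show ?thesis using large[of p k] D(1) mult_right_mono[of "real k + 1" _ "D ^ c"]
          by (fastforce simp: algebra_simps)
      qed
      have "real (card {d. d dvd n}) \<le> real ((k + 1) * card {d. d dvd m})"
        using card_divisors_prime_power_mult_le[OF p(1) \<open>m > 0\<close>, of k] unfolding m(1)[symmetric]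
        by (rule of_nat_mono)
      also have "\<dots> \<le> (real k + 1) * (D ^ c * real m powr \<epsilon>)"
        unfolding c_def of_nat_mult of_nat_add of_nat_1
        by (intro mult_left_mono less.IH[OF \<open>m < n\<close> \<open>m > 0\<close>]) auto
      also have "\<dots> \<le> (D ^ (if p < P then Suc c else c) * real p powr (k * \<epsilon>)) * real m powr \<epsilon>"
        using mult_right_mono[OF step, of "real m powr \<epsilon>"] by (simp only: mult.assoc powr_ge_zero)
      also have "real p powr (k * \<epsilon>) = real (p ^ k) powr \<epsilon>"
        using prime_gt_0_nat[OF p(1)] by (simp add: powr_powr flip: powr_realpow)
      finally show ?thesis unfolding cn
        by (simp add: m(1) powr_mult mult.assoc)
    qed auto
  qed
  show ?thesis
  proof
    fix n :: nat assume "n > 0"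
    have "card {p \<in> prime_factors n. p < P} \<le> card {..<P}" by (intro card_mono) auto
    then have "D ^ card {p \<in> prime_factors n. p < P} \<le> D ^ P" using D(1) by (intro power_increasing) auto
    then have "D ^ card {p \<in> prime_factors n. p < P} * real n powr \<epsilon> \<le> D ^ P * real n powr \<epsilon>"
      by (intro mult_right_mono) auto
    then show "real (card {d. d dvd n}) \<le> D ^ P * real n powr \<epsilon>" using main[OF \<open>n > 0\<close>] by linarith
  qed
qed

subsection \<open>Representations as sums of two squares\<close>

definition sum_squares_reps :: "nat \<Rightarrow> (int \<times> int) set" where
  "sum_squares_reps n = {(x, y). x\<^sup>2 + y\<^sup>2 = int n}"

definition primitive_reps :: "nat \<Rightarrow> (int \<times> int) set" where
  "primitive_reps n = {(x, y) \<in> sum_squares_reps n. coprime x y}"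

lemma finite_sum_squares_reps: "finite (sum_squares_reps n)"
proof (rule finite_subset)
  show "sum_squares_reps n \<subseteq> {- int n..int n} \<times> {- int n..int n}"
  proof -
    have "\<bar>x\<bar> \<le> int n" if "x\<^sup>2 + y\<^sup>2 = int n" for x y :: int
    proof -
      have "\<bar>x\<bar> * 1 \<le> \<bar>x\<bar> * \<bar>x\<bar>" if "x \<noteq> 0" using that by (intro mult_left_mono) auto
      then have "\<bar>x\<bar> \<le> x\<^sup>2" by (cases "x = 0") (auto simp: power2_eq_square)
      then show ?thesis using that zero_le_power2[of y] by linarith
    qed
    note this this[OF trans[OF add.commute]]
    then show ?thesis by (force simp: sum_squares_reps_def)
  qed
qed auto

lemma finite_primitive_reps: "finite (primitive_reps n)"
  by (rule finite_subset[OF _ finite_sum_squares_reps]) (auto simp: primitive_reps_def)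

text \<open>Modulo \<open>d\<close> both vectors are parallel to the primitive vector
  \<open>(u, v)\<close>, hence to each other: \<open>d\<close> divides the cross product times
  \<open>u\<close> and times \<open>v\<close>, and Bezout removes these factors.\<close>

lemma dvd_cross_product:
  fixes d u v x y x' y' :: int
  assumes "coprime u v" and "d dvd x * v - u * y" and "d dvd x' * v - u * y'"
  shows "d dvd x * y' - x' * y"
proof -
  have 1: "d dvd v * (x * y' - x' * y)"
  proof -
    have "v * (x * y' - x' * y) = y' * (x * v - u * y) - y * (x' * v - u * y')" by (simp add: algebra_simps)
    then show ?thesis using assms by simp
  qed
  have 2: "d dvd u * (x * y' - x' * y)"
  proof -
    have "u * (x * y' - x' * y) = x' * (x * v - u * y) - x * (x' * v - u * y')" by (simp add: algebra_simps)
    then show ?thesis using assms by simp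
  qed
  obtain a b where "a * u + b * v = 1" using assms(1) bezout_int[of u v] by (auto simp: coprime_iff_gcd_eq_1)
  then have "x * y' - x' * y = a * (u * (x * y' - x' * y)) + b * (v * (x * y' - x' * y))"
    by (metis distrib_right mult.assoc mult_1)
  then show ?thesis using 1 2 by (metis dvd_add dvd_mult)
qed

text \<open>
  A primitive solution is determined up to boundedly many choices by the divisor
  \<open>gcd (x v - u y) M\<close>, where \<open>(u, v)\<close> is a fixed primitive solution: two solutions with the same divisor
  have a cross product divisible by \<open>M / 2\<close>.
\<close>

lemma dvd_twice_cross_product:
  fixes M u v x y x' y' d :: int
  assumes "M > 0" and uv: "u\<^sup>2 + v\<^sup>2 = M" "coprime u v"
    and xy: "x\<^sup>2 + y\<^sup>2 = M" "coprime x y" and xy': "x'\<^sup>2 + y'\<^sup>2 = M"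
    and d: "d = gcd (x * v - u * y) M" "d = gcd (x' * v - u * y') M"
  shows "M dvd 2 * (x * y' - x' * y)"
proof -
  define c where "c = M div d"
  have M: "M = d * c" using d(1) by (simp add: c_def)
  have "d > 0" using d(1) \<open>M > 0\<close> by simp
  \<comment> \<open>Since \<open>(a * v - u * b) * (a * v + u * b)\<close> is a multiple of
    \<open>M\<close>, the part \<open>c\<close> of \<open>M\<close> not captured by the first factor
    must divide the second.\<close>
  have c: "c dvd a * v + u * b" if ab: "a\<^sup>2 + b\<^sup>2 = M" and da: "d = gcd (a * v - u * b) M" for a b
  proof -
    obtain w where w: "a * v - u * b = d * w" using da by (metis gcd_dvd1 dvdE)
    have "d * gcd w c = d" using da w M \<open>d > 0\<close> gcd_mult_left[of d w c] by (simp add: abs_of_pos)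
    then have "coprime c w" using \<open>d > 0\<close> by (simp add: coprime_iff_gcd_eq_1 gcd.commute)
    have "(a * v - u * b) * (a * v + u * b) = a\<^sup>2 * v\<^sup>2 - u\<^sup>2 * b\<^sup>2"
      by (simp add: algebra_simps power2_eq_square)
    also have "\<dots> = M * (a\<^sup>2 - u\<^sup>2)"
      using arg_cong[OF ab, of "\<lambda>t. u\<^sup>2 * t"] arg_cong[OF uv(1), of "\<lambda>t. a\<^sup>2 * t"]
      by (simp add: algebra_simps)
    finally have "d * (w * (a * v + u * b)) = d * (c * (a\<^sup>2 - u\<^sup>2))" using w M by (simp add: mult.assoc)
    then have "w * (a * v + u * b) = c * (a\<^sup>2 - u\<^sup>2)" using \<open>d > 0\<close> by simp
    then have "c dvd w * (a * v + u * b)" by simp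
    then show ?thesis using \<open>coprime c w\<close> by (simp add: coprime_dvd_mult_right_iff)
  qed
  have 1: "d dvd x * y' - x' * y"
    using dvd_cross_product[OF uv(2)] d by (metis gcd_dvd1)
  \<comment> \<open>Up to sign, \<open>x * v + u * y\<close> is a cross product with the conjugate
    \<open>(u, - v)\<close>, so the parallelism argument also works modulo \<open>c\<close>.\<close>
  have "c dvd x * (- v) - u * y" "c dvd x' * (- v) - u * y'"
    using c[OF xy(1) d(1)] c[OF xy' d(2)] by (metis dvd_minus_iff minus_diff_eq minus_mult_right diff_minus_eq_add add.commute mult_minus_right)+
  then have 2: "c dvd x * y' - x' * y"
    using dvd_cross_product[of u "- v" c x y x' y'] uv(2) by simp
  \<comment> \<open>\<open>d\<close> and \<open>c\<close> need not be coprime, so only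
    \<open>lcm d c\<close> is known to divide the cross product. The loss \<open>g\<close> divides
    2: it divides \<open>2 * x * v\<close>, and \<open>x\<close>, \<open>v\<close> are coprime to
    \<open>M\<close>.\<close>
  define g where "g = gcd d c"
  have "g dvd 2"
  proof -
    have gM: "g dvd M" using M by (simp add: g_def)
    have copr: "coprime g a" if "a\<^sup>2 + b\<^sup>2 = M" "coprime a b" for a b :: int
    proof -
      have "coprime a (a * a + b\<^sup>2)"
        using that(2) unfolding coprime_iff_gcd_eq_1 gcd_add_mult by (simp flip: coprime_iff_gcd_eq_1)
      then have "coprime a M" using that(1) by (simp add: power2_eq_square)
      then show ?thesis using gM by (meson coprime_commute coprime_divisors dvd_refl)
    qed
    have "g dvd x * v - u * y" "g dvd x * v + u * y"
      using c[OF xy(1) d(1)] d(1) by (auto simp: g_def intro: dvd_trans[OF gcd_dvd2] dvd_trans[OF gcd_dvd1])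
    then have "g dvd (x * v - u * y) + (x * v + u * y)" by (rule dvd_add)
    then have "g dvd x * (v * 2)" by (simp add: algebra_simps)
    moreover have "coprime g x" "coprime g v"
      using copr[OF xy] copr[of v u] uv by (auto simp: coprime_commute add.commute)
    ultimately show ?thesis by (simp add: coprime_dvd_mult_right_iff)
  qed
  have "lcm d c dvd x * y' - x' * y" using 1 2 by simp
  moreover have "M = g * lcm d c"
    using M \<open>d > 0\<close> \<open>M > 0\<close> by (simp add: g_def zero_less_mult_iff)
  ultimately show ?thesis using \<open>g dvd 2\<close> by (metis mult_dvd_mono)
qed

text \<open>In a fibre of the gcd map, compare with one fixed member: twice the cross product is
  \<open>n\<close> times an integer in \<open>{-2..2}\<close>, and the sign of the dot product has
  three values, whence 15 = 5 * 3.\<close>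

lemma card_primitive_reps_le:
  assumes "n > 0"
  shows "card (primitive_reps n) \<le> 15 * card {d. d dvd n}"
proof (cases "primitive_reps n = {}")
  case False
  then obtain u v where uv: "u\<^sup>2 + v\<^sup>2 = int n" "coprime u v"
    by (auto simp: primitive_reps_def sum_squares_reps_def)
  define f where "f = (\<lambda>(x, y). nat (gcd (x * v - u * y) (int n)))"
  show ?thesis
  proof (rule card_le_fibres[where f = f])
    show "finite {d. d dvd n}" using assms by simp
    show "f ` primitive_reps n \<subseteq> {d. d dvd n}"
      by (auto simp: f_def primitive_reps_def sum_squares_reps_def nat_dvd_iff)
  next
    fix d
    define F where "F = {z \<in> primitive_reps n. f z = d}"
    have "card F \<le> 15"
    proof (cases "F = {}")
      case False
      then obtain x y where xy: "(x, y) \<in> F" by auto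
      then have xyn: "x\<^sup>2 + y\<^sup>2 = int n" by (auto simp: F_def primitive_reps_def sum_squares_reps_def)
      \<comment> \<open>Cross and dot product with the base point \<open>(x, y)\<close>; the
        two-squares identity ties them by \<open>\<Delta>^2 + D^2 = n^2\<close>.\<close>
      define \<Delta> D where "\<Delta> = (\<lambda>(x', y'). x * y' - x' * y)" and "D = (\<lambda>(x', y'). x * x' + y * y')"
      have dvd: "int n dvd 2 * \<Delta> z" if "z \<in> F" for z
      proof -
        have "int n dvd 2 * (x * snd z - fst z * y)"
        proof (rule dvd_twice_cross_product[OF _ uv xyn])
          show "int d = gcd (x * v - u * y) (int n)"
            using xy by (auto simp: F_def f_def)
          show "int d = gcd (fst z * v - u * snd z) (int n)"
            using that by (auto simp: F_def f_def case_prod_beta)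
          show "coprime x y" using xy by (simp add: F_def primitive_reps_def)
          show "(fst z)\<^sup>2 + (snd z)\<^sup>2 = int n"
            using that by (auto simp: F_def primitive_reps_def sum_squares_reps_def)
        qed (use assms in simp)
        then show ?thesis by (simp add: \<Delta>_def case_prod_beta)
      qed
      have sq: "(\<Delta> z)\<^sup>2 + (D z)\<^sup>2 = (int n)\<^sup>2" if "z \<in> F" for z
      proof -
        obtain x' y' where z: "z = (x', y')" by fastforce
        then have xyn': "x'\<^sup>2 + y'\<^sup>2 = int n" using that by (auto simp: F_def primitive_reps_def sum_squares_reps_def)
        have "(\<Delta> z)\<^sup>2 + (D z)\<^sup>2 = (x\<^sup>2 + y\<^sup>2) * (x'\<^sup>2 + y'\<^sup>2)"
          unfolding z \<Delta>_def D_def prod.case by (simp add: power2_eq_square algebra_simps)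
        then show ?thesis unfolding xyn xyn' by (simp add: power2_eq_square)
      qed
      \<comment> \<open>\<open>h\<close> fixes \<open>\<Delta>\<close> through divisibility, then
        \<open>|D|\<close> through the identity and \<open>D\<close> by its sign; cross and dot
        product together determine the point.\<close>
      define h where "h = (\<lambda>z. (2 * \<Delta> z div int n, sgn (D z)))"
      have "inj_on h F"
      proof (rule inj_onI)
        fix z w assume zw: "z \<in> F" "w \<in> F" "h z = h w"
        have eq: "2 * \<Delta> z div int n = 2 * \<Delta> w div int n" "sgn (D z) = sgn (D w)"
          using zw(3) unfolding h_def prod.inject by blast+
        have "2 * \<Delta> z = 2 * \<Delta> w"
          by (rule trans[OF dvd_div_mult_self[OF dvd[OF zw(1)], symmetric, unfolded eq(1)]
                dvd_div_mult_self[OF dvd[OF zw(2)]]])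
        then have \<Delta>: "\<Delta> z = \<Delta> w" by simp
        then have "(D z)\<^sup>2 = (D w)\<^sup>2" using sq[OF zw(1)] sq[OF zw(2)] by simp
        then have "\<bar>D z\<bar> = \<bar>D w\<bar>" by (simp add: power2_eq_iff abs_eq_iff)
        then have D: "D z = D w" using eq(2) by (metis sgn_mult_abs)
        have "int n * fst z = int n * fst w" "int n * snd z = int n * snd w"
        proof -
          have 1: "int n * fst z = x * D z - y * \<Delta> z" "int n * snd z = y * D z + x * \<Delta> z" for z
            unfolding xyn[symmetric] \<Delta>_def D_def by (auto simp: case_prod_beta power2_eq_square algebra_simps)
          show "int n * fst z = int n * fst w" "int n * snd z = int n * snd w"
            unfolding 1 by (simp_all only: \<Delta> D)
        qed
        then show "z = w" using assms by (simp add: prod_eq_iff)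
      qed
      have "h ` F \<subseteq> {-2..2} \<times> {-1, 0, 1}"
      proof
        fix t assume "t \<in> h ` F"
        then obtain z where z: "z \<in> F" "t = h z" by auto
        have "(\<Delta> z)\<^sup>2 \<le> (int n)\<^sup>2" using sq[OF z(1)] zero_le_power2[of "D z"] by linarith
        then have "\<bar>\<Delta> z\<bar> \<le> int n" using abs_le_square_iff[of "\<Delta> z" "int n"] by simp
        moreover obtain j where "2 * \<Delta> z = int n * j" using dvd[OF z(1)] by (elim dvdE)
        ultimately have "int n * j \<le> int n * 2" "int n * (-2) \<le> int n * j" by auto
        then have "-2 \<le> j" "j \<le> 2" using assms by (simp_all only: mult_le_cancel_left_pos of_nat_0_less_iff)
        moreover have "2 * \<Delta> z div int n = j" using \<open>2 * \<Delta> z = int n * j\<close> assms by simp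
        moreover have "sgn (D z) \<in> {-1, 0, 1}" by (auto simp: sgn_if)
        ultimately show "t \<in> {-2..2} \<times> {-1, 0, 1}" unfolding z(2) h_def by auto
      qed
      then have "card F \<le> card ({-2..2::int} \<times> {-1, 0, 1::int})"
        using \<open>inj_on h F\<close> by (intro card_inj_on_le[of h]) auto
      then show ?thesis by simp
    qed auto
    then show "finite {z \<in> primitive_reps n. f z = d} \<and> card {z \<in> primitive_reps n. f z = d} \<le> 15"
      unfolding F_def using finite_primitive_reps by simp
  qed
qed auto

text \<open>Dividing by \<open>g = gcd x y\<close> turns a representation of \<open>n\<close> into a
  primitive one of \<open>n / g^2\<close>. One factor of the divisor count bounds the choices of
  \<open>g\<close>, the other the primitive representations.\<close>

lemma card_sum_squares_reps_le:
  assumes "n > 0"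
  shows "card (sum_squares_reps n) \<le> 15 * (card {d. d dvd n})\<^sup>2"
proof -
  define f :: "int \<times> int \<Rightarrow> nat" where "f = (\<lambda>(x, y). nat (gcd x y))"
  have sqdvd: "(f z)\<^sup>2 dvd n" if "z \<in> sum_squares_reps n" for z
  proof -
    obtain x y where z: "z = (x, y)" by fastforce
    have "(gcd x y)\<^sup>2 dvd x\<^sup>2 + y\<^sup>2" by (intro dvd_add dvd_power_same) auto
    also have "x\<^sup>2 + y\<^sup>2 = int n" using that by (simp add: z sum_squares_reps_def)
    finally have "int ((f z)\<^sup>2) dvd int n" by (simp add: z f_def)
    then show ?thesis by (simp only: int_dvd_int_iff)
  qed
  have "card (sum_squares_reps n) \<le> (15 * card {d. d dvd n}) * card {d. d dvd n}"
  proof (rule card_le_fibres[where f = f])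
    show "finite {d. d dvd n}" using assms by simp
    show "f ` sum_squares_reps n \<subseteq> {d. d dvd n}"
      using sqdvd by (auto simp: power2_eq_square dest!: dvd_mult_left)
  next
    fix g
    define F where "F = {z \<in> sum_squares_reps n. f z = g}"
    have "card F \<le> 15 * card {d. d dvd n}"
    proof (cases "F = {}")
      case False
      then have "g\<^sup>2 dvd n" using sqdvd by (auto simp: F_def)
      then obtain m where m: "n = g\<^sup>2 * m" by (elim dvdE)
      then have "g > 0" "m > 0" using assms by auto
      define h where "h = (\<lambda>(x, y). (x div int g, y div int g))"
      have gcd: "gcd (fst z) (snd z) = int g" if "z \<in> F" for z
        using that by (cases z) (auto simp: F_def f_def)
      have "inj_on h F"
      proof (rule inj_onI)
        fix z w assume zw: "z \<in> F" "w \<in> F" "h z = h w"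
        have "fst z = fst w" "snd z = snd w"
          using zw(3) gcd[OF zw(1)] gcd[OF zw(2)] unfolding h_def case_prod_beta
          by (metis dvd_div_mult_self gcd_dvd1 prod.inject, metis dvd_div_mult_self gcd_dvd2 prod.inject)
        then show "z = w" by (simp add: prod_eq_iff)
      qed
      moreover have "h ` F \<subseteq> primitive_reps m"
      proof
        fix t assume "t \<in> h ` F"
        then obtain x y where z: "(x, y) \<in> F" "t = h (x, y)" by auto
        have g: "gcd x y = int g" using gcd[OF z(1)] by simp
        then obtain a b where ab: "x = int g * a" "y = int g * b" by (metis gcd_dvd1 gcd_dvd2 dvdE)
        have "int g * gcd a b = int g" using g ab \<open>g > 0\<close> by (simp add: gcd_mult_left)
        then have "coprime a b" using \<open>g > 0\<close> by (simp add: coprime_iff_gcd_eq_1)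
        have "x\<^sup>2 + y\<^sup>2 = int n" using z(1) by (auto simp: F_def sum_squares_reps_def)
        then have "(int g)\<^sup>2 * (a\<^sup>2 + b\<^sup>2) = (int g)\<^sup>2 * int m"
          unfolding m ab by (simp add: power_mult_distrib algebra_simps)
        then have "a\<^sup>2 + b\<^sup>2 = int m" using \<open>g > 0\<close> by simp
        then show "t \<in> primitive_reps m"
          using \<open>coprime a b\<close> \<open>g > 0\<close> by (simp add: z(2) h_def ab primitive_reps_def sum_squares_reps_def)
      qed
      ultimately have "card F \<le> card (primitive_reps m)"
        by (intro card_inj_on_le finite_primitive_reps)
      also have "\<dots> \<le> 15 * card {d. d dvd m}" by (rule card_primitive_reps_le[OF \<open>m > 0\<close>])
      also have "card {d. d dvd m} \<le> card {d. d dvd n}"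
        using assms by (intro card_mono) (auto simp: m)
      finally show ?thesis by simp
    qed auto
    then show "finite {z \<in> sum_squares_reps n. f z = g} \<and> card {z \<in> sum_squares_reps n. f z = g} \<le> 15 * card {d. d dvd n}"
      unfolding F_def using finite_sum_squares_reps by simp
  qed
  then show ?thesis by (simp add: power2_eq_square)
qed

subsection \<open>Geometry of the semicircle\<close>

text \<open>
  On the circle of radius \<open>r\<close> the sum \<open>s\<close> of two points determines their product \<open>P\<close> through
  \<open>r\<^sup>2 s = P \<cdot> cnj s\<close>. Comparing the quadratics with roots \<open>n\<^sub>1, n\<^sub>2\<close> and \<open>m\<^sub>1, m\<^sub>2\<close> at \<open>m\<^sub>1\<close> then bounds
  \<open>|m\<^sub>1 - n\<^sub>1| |m\<^sub>1 - n\<^sub>2|\<close>. The relation degenerates as \<open>s\<close> tends to \<open>0\<close>; there the upper half plane is needed.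
\<close>

lemma chord_min_le:
  fixes m\<^sub>1 m\<^sub>2 n\<^sub>1 n\<^sub>2 :: complex
  assumes r: "r > 0" and norms: "cmod m\<^sub>1 = r" "cmod m\<^sub>2 = r" "cmod n\<^sub>1 = r" "cmod n\<^sub>2 = r"
    and Im: "Im m\<^sub>1 \<ge> 0" "Im m\<^sub>2 \<ge> 0" "Im n\<^sub>1 \<ge> 0" "Im n\<^sub>2 \<ge> 0"
    and R: "0 < R" "R \<le> r" and close: "cmod ((n\<^sub>1 + n\<^sub>2) - (m\<^sub>1 + m\<^sub>2)) \<le> R"
  shows "min (cmod (m\<^sub>1 - n\<^sub>1)) (cmod (m\<^sub>1 - n\<^sub>2)) \<le> 20 * sqrt (r * R)"
proof (rule ccontr)
  \<comment> \<open>The length scale of the claim, with \<open>R \<le> q \<le> r\<close>. The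
    negated claim makes both distances exceed \<open>20 * q\<close>.\<close>
  define q where "q = sqrt (r * R)"
  define s s' P P' where "s = n\<^sub>1 + n\<^sub>2" "s' = m\<^sub>1 + m\<^sub>2" "P = n\<^sub>1 * n\<^sub>2" "P' = m\<^sub>1 * m\<^sub>2"
  note defs = this
  assume "\<not> ?thesis"
  then have far: "cmod (m\<^sub>1 - n\<^sub>1) > 20 * q" "cmod (m\<^sub>1 - n\<^sub>2) > 20 * q" by (auto simp: q_def)
  have q2: "q * q = r * R" and "q > 0" using r R by (auto simp: q_def)
  have "R * R \<le> q * q" unfolding q2 using r R by (intro mult_right_mono) auto
  then have "R \<le> q" using \<open>q > 0\<close> by (metis abs_of_pos R(1) power2_eq_square abs_le_square_iff)
  have "q * q \<le> r * r" unfolding q2 using r R by (intro mult_left_mono) auto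
  then have "q \<le> r" using \<open>q > 0\<close> by (metis abs_of_pos r power2_eq_square abs_le_square_iff)
  have sR: "cmod (s - s') \<le> R" using close by (simp add: defs)
  have norm_eq: "z * cnj z = of_real (r\<^sup>2)" if "cmod z = r" for z
    using that by (simp add: complex_norm_square[symmetric])
  have PP: "cmod P = r\<^sup>2" "cmod P' = r\<^sup>2"
    using norms by (auto simp: defs norm_mult power2_eq_square)
  have "(m\<^sub>1 - n\<^sub>1) * (m\<^sub>1 - n\<^sub>2) = (s' - s) * m\<^sub>1 + (P - P')"
    by (simp add: defs algebra_simps)
  then have "cmod (m\<^sub>1 - n\<^sub>1) * cmod (m\<^sub>1 - n\<^sub>2) \<le> cmod ((s' - s) * m\<^sub>1) + cmod (P - P')"
    by (metis norm_mult norm_triangle_ineq)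
  also have "cmod ((s' - s) * m\<^sub>1) \<le> R * r"
    using sR norms r by (simp add: norm_mult norm_minus_commute mult_right_mono)
  finally have prod: "cmod (m\<^sub>1 - n\<^sub>1) * cmod (m\<^sub>1 - n\<^sub>2) \<le> q * q + cmod (P - P')"
    by (simp add: q2 mult.commute)
  have s_cnj: "of_real (r\<^sup>2) * (x + y) = x * y * cnj (x + y)" if "cmod x = r" "cmod y = r" for x y
  proof -
    have "x * y * cnj (x + y) = (x * cnj x) * y + x * (y * cnj y)" by (simp add: algebra_simps)
    then show ?thesis unfolding norm_eq[OF that(1)] norm_eq[OF that(2)] by (simp add: algebra_simps)
  qed
  \<comment> \<open>Subtract the relations \<open>r^2 * s = P * cnj s\<close> and
    \<open>r^2 * s' = P' * cnj s'\<close>. Both terms on the right have modulus at most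
    \<open>r^2 * R\<close>, which controls \<open>P - P'\<close> unless \<open>s\<close> is
    small.\<close>
  have "cnj s * (P - P') = of_real (r\<^sup>2) * (s - s') + P' * cnj (s' - s)"
    using s_cnj[OF norms(1,2)] s_cnj[OF norms(3,4)] by (simp add: defs algebra_simps)
  then have "cmod s * cmod (P - P') = cmod (of_real (r\<^sup>2) * (s - s') + P' * cnj (s' - s))"
    by (metis norm_mult complex_mod_cnj)
  also have "\<dots> \<le> cmod (of_real (r\<^sup>2) * (s - s')) + cmod (P' * cnj (s' - s))"
    by (rule norm_triangle_ineq)
  also have "\<dots> = 2 * r\<^sup>2 * cmod (s - s')"
    by (simp only: norm_mult complex_mod_cnj PP norm_minus_commute[of s' s]) (simp add: norm_power)
  also have "\<dots> \<le> 2 * r\<^sup>2 * R" using sR by (intro mult_left_mono) auto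
  finally have sPP: "cmod s * cmod (P - P') \<le> 2 * r\<^sup>2 * R" .
  show False
  \<comment> \<open>For \<open>|s| \<ge> r\<close> the product of the distances is at most
    \<open>3 * q * q\<close>, against more than \<open>400 * q * q\<close>. Otherwise the bound
    weakens to \<open>10 * r * q\<close>, but then \<open>n\<^sub>1\<close> and
    \<open>n\<^sub>2\<close> are at least \<open>r\<close> apart by the parallelogram law. So one
    distance is at least \<open>r / 2\<close>, and \<open>20 * q\<close> for the other gives the
    contradiction.\<close>
  proof (cases "cmod s \<ge> r")
    case True
    then have "r * cmod (P - P') \<le> cmod s * cmod (P - P')" by (intro mult_right_mono) auto
    then have "r * cmod (P - P') \<le> r * (2 * (q * q))"
      using sPP unfolding q2 by (simp add: power2_eq_square algebra_simps)
    then have "cmod (P - P') \<le> 2 * (q * q)" using r by simp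
    then have "cmod (m\<^sub>1 - n\<^sub>1) * cmod (m\<^sub>1 - n\<^sub>2) \<le> 3 * (q * q)" using prod by simp
    moreover have "(20 * q) * (20 * q) < cmod (m\<^sub>1 - n\<^sub>1) * cmod (m\<^sub>1 - n\<^sub>2)"
      using far \<open>q > 0\<close> by (intro mult_strict_mono) auto
    moreover have "q * q > 0" using \<open>q > 0\<close> by simp
    ultimately show False by simp
  next
    case False
    have "cmod (P - P') \<le> 9 * (r * q)"
    proof (cases "cmod s \<ge> q")
      case True
      then have "q * cmod (P - P') \<le> cmod s * cmod (P - P')" by (intro mult_right_mono) auto
      then have "q * cmod (P - P') \<le> q * (2 * (r * q))"
        using sPP arg_cong[OF q2, of "\<lambda>t. 2 * (r * t)"] by (simp only: power2_eq_square mult_ac)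
      then have "cmod (P - P') \<le> 2 * (r * q)" using \<open>q > 0\<close> by simp
      moreover have "r * q > 0" using r \<open>q > 0\<close> by simp
      ultimately show ?thesis by simp
    next
      case False
      text \<open>In the upper half plane a small sum forces both points near the real axis.\<close>
      have near: "cmod (x * y + of_real (r\<^sup>2)) \<le> r * (3 * cmod (x + y))"
        if "cmod x = r" "cmod y = r" "Im x \<ge> 0" "Im y \<ge> 0" for x y
      proof -
        have "x * y + of_real (r\<^sup>2) = x * ((x + y) + (cnj x - x))"
          unfolding norm_eq[OF that(1), symmetric] by (simp add: algebra_simps)
        then have "cmod (x * y + of_real (r\<^sup>2)) = r * cmod ((x + y) + (cnj x - x))"
          using that(1) by (simp add: norm_mult)
        also have "\<dots> \<le> r * (cmod (x + y) + cmod (cnj x - x))"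
          using r by (intro mult_left_mono norm_triangle_ineq) auto
        also have "cmod (cnj x - x) = 2 * Im x"
        proof -
          have "cnj x - x = - (2 * \<i> * Im x)" by (simp add: complex_eq_iff)
          then show ?thesis using that(3) by (simp add: norm_mult)
        qed
        also have "Im x \<le> cmod (x + y)" using abs_Im_le_cmod[of "x + y"] that(3,4) by simp
        finally show ?thesis using r by (simp add: mult_left_mono)
      qed
      \<comment> \<open>Both products are near \<open>- r^2\<close>, and
        \<open>3 * (|s| + |s'|) \<le> 3 * (2 * q + R) \<le> 9 * q\<close>.\<close>
      have "cmod (P - P') \<le> cmod (P + of_real (r\<^sup>2)) + cmod (P' + of_real (r\<^sup>2))"
        using norm_triangle_ineq4[of "P + of_real (r\<^sup>2)" "P' + of_real (r\<^sup>2)"] by simp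
      also have "\<dots> \<le> r * (3 * cmod s) + r * (3 * cmod s')"
        unfolding defs using norms Im by (intro add_mono near) auto
      also have "cmod s' \<le> cmod s + R"
        using norm_triangle_ineq2[of s' s] sR by (simp add: norm_minus_commute)
      also have "r * (3 * cmod s) + r * (3 * (cmod s + R)) \<le> r * (9 * q)"
        unfolding distrib_left[symmetric] using False \<open>R \<le> q\<close> r by (intro mult_left_mono) auto
      finally show ?thesis using r by (simp add: mult_left_mono algebra_simps)
    qed
    moreover have "q * q \<le> r * q" using \<open>q \<le> r\<close> \<open>q > 0\<close> by (intro mult_right_mono) auto
    ultimately have prod': "cmod (m\<^sub>1 - n\<^sub>1) * cmod (m\<^sub>1 - n\<^sub>2) \<le> 10 * (r * q)" using prod by simp
    have "(cmod (n\<^sub>1 - n\<^sub>2))\<^sup>2 + (cmod s)\<^sup>2 = 4 * r\<^sup>2"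
    proof -
      have "(Re n\<^sub>1)\<^sup>2 + (Im n\<^sub>1)\<^sup>2 = r\<^sup>2" "(Re n\<^sub>2)\<^sup>2 + (Im n\<^sub>2)\<^sup>2 = r\<^sup>2"
        using norms(3,4) by (metis cmod_power2)+
      then show ?thesis by (simp add: cmod_power2 defs power2_sum power2_diff)
    qed
    moreover have "(cmod s)\<^sup>2 \<le> r\<^sup>2" using False by (intro power_mono) auto
    ultimately have "r\<^sup>2 \<le> (cmod (n\<^sub>1 - n\<^sub>2))\<^sup>2" using zero_le_power2[of r] by linarith
    then have "r \<le> cmod (n\<^sub>1 - n\<^sub>2)" by (rule power2_le_imp_le) simp
    also have "\<dots> \<le> cmod (m\<^sub>1 - n\<^sub>1) + cmod (m\<^sub>1 - n\<^sub>2)"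
      using norm_triangle_ineq4[of "m\<^sub>1 - n\<^sub>2" "m\<^sub>1 - n\<^sub>1"] by simp
    finally consider "r / 2 \<le> cmod (m\<^sub>1 - n\<^sub>1)" | "r / 2 \<le> cmod (m\<^sub>1 - n\<^sub>2)" by linarith
    then have "10 * (r * q) < cmod (m\<^sub>1 - n\<^sub>1) * cmod (m\<^sub>1 - n\<^sub>2)"
    proof cases
      case 1
      then have "(r / 2) * (20 * q) < cmod (m\<^sub>1 - n\<^sub>1) * cmod (m\<^sub>1 - n\<^sub>2)"
        using far \<open>q > 0\<close> r by (intro mult_le_less_imp_less) auto
      moreover have "(r / 2) * (20 * q) = 10 * (r * q)" by simp
      ultimately show ?thesis by (simp only:)
    next
      case 2
      then have "(20 * q) * (r / 2) < cmod (m\<^sub>1 - n\<^sub>1) * cmod (m\<^sub>1 - n\<^sub>2)"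
        using far \<open>q > 0\<close> r by (intro mult_less_le_imp_less) auto
      moreover have "(20 * q) * (r / 2) = 10 * (r * q)" by simp
      ultimately show ?thesis by (simp only:)
    qed
    then show False using prod' by simp
  qed
qed

lemma upper_semicircle_min_dist_le:
  assumes "N > 0" "{m\<^sub>1, m\<^sub>2, n\<^sub>1, n\<^sub>2} \<subseteq> upper_semicircle N"
    and "0 < R" "R \<le> sqrt N" "norm ((n\<^sub>1 + n\<^sub>2) - (m\<^sub>1 + m\<^sub>2)) \<le> R"
  shows "min (norm (m\<^sub>1 - n\<^sub>1)) (norm (m\<^sub>1 - n\<^sub>2)) \<le> 20 * sqrt (sqrt N * R)"
proof -
  define c where "c = (\<lambda>x :: real \<times> real. Complex (fst x) (snd x))"
  have norm: "cmod (c x) = norm x" for x by (simp add: c_def cmod_def norm_prod_def)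
  have lin: "c x + c y = c (x + y)" "c x - c y = c (x - y)" for x y by (simp_all add: c_def complex_eq_iff)
  have "min (cmod (c m\<^sub>1 - c n\<^sub>1)) (cmod (c m\<^sub>1 - c n\<^sub>2)) \<le> 20 * sqrt (sqrt N * R)"
    using assms by (intro chord_min_le[where m\<^sub>2 = "c m\<^sub>2"]) (simp_all only: lin norm, auto simp: upper_semicircle_def c_def)
  then show ?thesis by (simp only: lin norm)
qed

section \<open>Arc length against chord length, and lattice points near a point of the
  circle\<close>

lemma le_four_times_sin:
  fixes x :: real
  assumes "0 \<le> x" "x \<le> pi / 2"
  shows "x \<le> 4 * sin x"
\<comment> \<open>Up to \<open>pi / 3\<close> the derivative \<open>cos\<close> is at least 1/2;
  beyond it \<open>sin x \<ge> 1/2\<close>, while \<open>x \<le> pi / 2 < 2\<close>.\<close>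
proof (cases "x \<le> pi / 3")
  case True
  have "\<exists>z>0. z < x \<and> sin x - sin 0 = (x - 0) * cos z" if "x > 0"
    using that by (intro MVT2) auto
  then obtain z where z: "x > 0 \<Longrightarrow> 0 < z \<and> z < x \<and> sin x = x * cos z" by auto
  show ?thesis
  proof (cases "x = 0")
    case False
    then have "0 < z" "z < x" "sin x = x * cos z" using z assms by auto
    moreover have "cos (pi / 3) \<le> cos z"
      using \<open>0 < z\<close> \<open>z < x\<close> True by (intro cos_monotone_0_pi_le) auto
    ultimately have "x * (1 / 2) \<le> sin x"
      using assms by (simp add: cos_60 mult_left_mono)
    then show ?thesis using assms by simp
  qed auto
next
  case False
  then have "sin (pi / 6) \<le> sin x" using assms by (intro sin_monotone_2pi_le) auto
  then show ?thesis using assms pi_less_4 by (simp add: sin_30)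
qed

text \<open>The chord over an angle \<open>2 * t\<close> has length \<open>2 * r * sin t\<close>.
  This turns closeness in the plane into closeness in angle.\<close>

lemma dist_circle_ge:
  fixes \<theta> \<phi> r :: real
  assumes "r \<ge> 0" "\<theta> \<in> {0..pi}" "\<phi> \<in> {0..pi}"
  shows "r * \<bar>\<theta> - \<phi>\<bar> \<le> 4 * norm (r *\<^sub>R (cos \<theta>, sin \<theta>) - r *\<^sub>R (cos \<phi>, sin \<phi>))"
proof -
  define t where "t = \<bar>\<theta> - \<phi>\<bar> / 2"
  have t: "0 \<le> t" "t \<le> pi / 2" using assms by (auto simp: t_def)
  have "(cos \<theta> - cos \<phi>)\<^sup>2 + (sin \<theta> - sin \<phi>)\<^sup>2 = 2 - 2 * cos (\<theta> - \<phi>)"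
    using sin_cos_squared_add[of \<theta>] sin_cos_squared_add[of \<phi>]
    unfolding cos_diff power2_diff by (simp add: algebra_simps)
  also have "cos (\<theta> - \<phi>) = cos (2 * t)"
    using cos_minus[of "\<theta> - \<phi>"] by (simp add: t_def abs_if)
  also have "2 - 2 * cos (2 * t) = (2 * sin t)\<^sup>2" by (simp add: cos_double_sin power_mult_distrib)
  finally have "norm ((cos \<theta>, sin \<theta>) - (cos \<phi>, sin \<phi>)) = 2 * sin t"
    using t sin_ge_zero[of t] by (simp add: norm_prod_def real_sqrt_mult)
  then have "norm (r *\<^sub>R (cos \<theta>, sin \<theta>) - r *\<^sub>R (cos \<phi>, sin \<phi>)) = r * (2 * sin t)"
    unfolding scaleR_diff_right[symmetric] norm_scaleR using assms by simp
  moreover have "r * t \<le> r * (4 * sin t)" using le_four_times_sin[OF t] assms by (intro mult_left_mono)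
  ultimately show ?thesis by (simp add: t_def)
qed

lemma finite_S: "finite (S N)" and card_S_le: "card (S N) \<le> card (sum_squares_reps N)"
proof -
  have sub: "S N \<subseteq> (\<lambda>(x, y). (of_int x, of_int y)) ` sum_squares_reps N"
  proof
    fix z assume "z \<in> S N"
    then obtain x y where xy: "z = (of_int x, of_int y)" "norm z = sqrt N"
      by (auto simp: S_def upper_semicircle_def lattice2_def elim!: Ints_cases)
    then have "(of_int x)\<^sup>2 + (of_int y)\<^sup>2 = (real_of_int (int N))" by (simp add: norm_prod_def)
    then have "x\<^sup>2 + y\<^sup>2 = int N" by (metis of_int_add of_int_eq_iff of_int_power)
    then show "z \<in> (\<lambda>(x, y). (of_int x, of_int y)) ` sum_squares_reps N"
      using xy by (auto simp: sum_squares_reps_def)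
  qed
  show "finite (S N)" using sub finite_sum_squares_reps by (rule finite_surj[rotated])
  show "card (S N) \<le> card (sum_squares_reps N)" using finite_sum_squares_reps sub by (rule surj_card_le)
qed

lemma upper_semicircle_polar:
  assumes "x \<in> upper_semicircle N"
  obtains \<theta> where "\<theta> \<in> {0..pi}" "x = sqrt N *\<^sub>R (cos \<theta>, sin \<theta>)"
proof (cases "N = 0")
  case True
  then show ?thesis using assms that[of 0] by (auto simp: upper_semicircle_def zero_prod_def)
next
  case False
  define r where "r = sqrt N"
  have "r > 0" using False by (simp add: r_def)
  have "sqrt ((fst x)\<^sup>2 + (snd x)\<^sup>2) = r" "snd x \<ge> 0"
    using assms by (auto simp: upper_semicircle_def norm_prod_def r_def)
  then have "(fst x)\<^sup>2 + (snd x)\<^sup>2 = r\<^sup>2" by (metis real_sqrt_pow2 sum_power2_ge_zero)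
  then have "(fst x / r)\<^sup>2 + (snd x / r)\<^sup>2 = 1" using \<open>r > 0\<close> by (simp add: field_simps)
  moreover have "snd x / r \<ge> 0" using \<open>snd x \<ge> 0\<close> \<open>r > 0\<close> by simp
  ultimately obtain t where t: "0 \<le> t" "t \<le> pi" "fst x / r = cos t" "snd x / r = sin t"
    using sincos_total_pi by metis
  then have "x = r *\<^sub>R (cos t, sin t)" using \<open>r > 0\<close> by (auto simp: prod_eq_iff field_simps)
  then show ?thesis using t that[of t] by (simp add: r_def)
qed

text \<open>Points within \<open>\<rho>\<close> of \<open>n\<close> have angle within
  \<open>l / 2\<close> of that of \<open>n\<close>, because
  \<open>r * |\<theta> - \<phi>| \<le> 4 * \<rho> \<le> L / 2\<close>. They all lie on one arc of
  length exactly \<open>L\<close>, which fits into the semicircle since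
  \<open>L \<le> sqrt N\<close>.\<close>

lemma card_close_points_le:
  fixes L \<rho> B :: real
  assumes "N > 0" and arcs: "\<And>A. is_arc N L A \<Longrightarrow> real (card (A \<inter> lattice2)) \<le> B"
    and L: "0 \<le> L" "L \<le> sqrt N" "8 * \<rho> \<le> L" and n: "n \<in> upper_semicircle N"
  shows "real (card {m \<in> S N. norm (m - n) \<le> \<rho>}) \<le> B"
proof -
  define r where "r = sqrt N"
  have "r > 0" using \<open>N > 0\<close> by (simp add: r_def)
  define l where "l = L / r"
  have "0 \<le> l" "l \<le> 1" "L = r * l" using L \<open>r > 0\<close> by (auto simp: l_def r_def[symmetric])
  then have l: "0 \<le> l" "l \<le> pi" "L = r * l" using pi_gt3 by auto
  obtain \<phi> where \<phi>: "\<phi> \<in> {0..pi}" "n = r *\<^sub>R (cos \<phi>, sin \<phi>)"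
    using upper_semicircle_polar[OF n] unfolding r_def by metis
  \<comment> \<open>The window of width \<open>l\<close> centred at \<open>\<phi>\<close> is slid
    back into \<open>{0..pi}\<close> near the endpoints; it still contains every angle of
    \<open>{0..pi}\<close> within \<open>l / 2\<close> of \<open>\<phi>\<close>.\<close>
  define a where "a = min (max (\<phi> - l / 2) 0) (pi - l)"
  define A where "A = (\<lambda>\<theta>. r *\<^sub>R (cos \<theta>, sin \<theta>)) ` {a..a + l}"
  have "0 \<le> a" "a + l \<le> pi" using l by (auto simp: a_def)
  then have "is_arc N L A"
    unfolding is_arc_def using l by (intro exI[of _ a] exI[of _ "a + l"]) (simp add: A_def r_def)
  have sub: "{m \<in> S N. norm (m - n) \<le> \<rho>} \<subseteq> A \<inter> lattice2"
  proof
    fix m assume m: "m \<in> {m \<in> S N. norm (m - n) \<le> \<rho>}"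
    then obtain \<theta> where \<theta>: "\<theta> \<in> {0..pi}" "m = r *\<^sub>R (cos \<theta>, sin \<theta>)"
      using upper_semicircle_polar[of m N] unfolding r_def S_def by blast
    have "r * \<bar>\<theta> - \<phi>\<bar> \<le> 4 * norm (m - n)"
      unfolding \<theta> \<phi> using \<open>r > 0\<close> \<theta>(1) \<phi>(1) by (intro dist_circle_ge) auto
    also have "\<dots> \<le> r * (l / 2)" using m L(3) l(3) by auto
    finally have "\<bar>\<theta> - \<phi>\<bar> \<le> l / 2" using \<open>r > 0\<close> by (simp only: mult_le_cancel_left_pos)
    then have "\<theta> \<in> {a..a + l}" using \<theta>(1) \<phi>(1) l unfolding a_def abs_le_iff atLeastAtMost_iff by linarith
    then show "m \<in> A \<inter> lattice2" using m by (auto simp: A_def \<theta>(2) S_def)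
  qed
  \<comment> \<open>Gives finiteness, without which \<open>card\<close>, being 0 on infinite sets,
    is not monotone.\<close>
  have "A \<inter> lattice2 \<subseteq> S N"
  proof
    fix x assume x: "x \<in> A \<inter> lattice2"
    then obtain \<theta> where "\<theta> \<in> {a..a + l}" "x = r *\<^sub>R (cos \<theta>, sin \<theta>)" by (auto simp: A_def)
    moreover from this have "sin \<theta> \<ge> 0" using \<open>0 \<le> a\<close> \<open>a + l \<le> pi\<close> by (intro sin_ge_zero) auto
    moreover have "norm (cos \<theta>, sin \<theta>) = 1" by (simp add: norm_prod_def)
    ultimately show "x \<in> S N"
      using x \<open>r > 0\<close> unfolding S_def upper_semicircle_def by (auto simp: norm_scaleR simp flip: r_def scaleR_Pair)
  qed
  then have "finite (A \<inter> lattice2)" using finite_S by (rule finite_subset)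
  then have "card {m \<in> S N. norm (m - n) \<le> \<rho>} \<le> card (A \<inter> lattice2)" using sub by (rule card_mono)
  then show ?thesis using arcs[OF \<open>is_arc N L A\<close>] by linarith
qed

subsection \<open>Expansion of the fourth power; the Schur test\<close>

lemma e_add: "e (s + t) = e s * e t"
  by (simp add: e_def ring_distribs exp_add)

lemma cnj_e: "cnj (e t) = e (- t)"
  by (simp add: e_def exp_cnj)

lemma norm_e [simp]: "norm (e t) = 1"
  by (simp add: e_def norm_exp_eq_Re)

lemma continuous_on_e [continuous_intros]:
  "continuous_on A f \<Longrightarrow> continuous_on A (\<lambda>x. e (f x))"
  unfolding e_def by (intro continuous_intros)

lemma integrable_character:
  assumes "finite_measure \<sigma>" and "sets \<sigma> = sets torus2"
  shows "integrable \<sigma> (\<lambda>x. e (\<xi> \<bullet> x))"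
proof (rule finite_measure.integrable_const_bound[OF assms(1)])
  have "(\<lambda>x :: real \<times> real. e (\<xi> \<bullet> x)) \<in> borel_measurable borel"
    by (intro borel_measurable_continuous_onI continuous_intros)
  then have "(\<lambda>x. e (\<xi> \<bullet> x)) \<in> borel_measurable torus2"
    unfolding torus2_def by (rule measurable_restrict_space1)
  then show "(\<lambda>x. e (\<xi> \<bullet> x)) \<in> borel_measurable \<sigma>"
    by (simp cong: measurable_cong_sets add: assms(2))
qed (auto intro!: always_eventually)

text \<open>Expands \<open>(F * F) * cnj (F * F)\<close>, where \<open>F * F\<close> is a sum over
  pairs. The exponent follows the sign convention of \<open>fourier_coeff\<close>, so integration
  yields the coefficient at \<open>s q - s p\<close>.\<close>

lemma norm_trig_sum_power4:
  fixes T :: "(real \<times> real) set" and a :: "real \<times> real \<Rightarrow> complex"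
  defines "c \<equiv> \<lambda>p. a (fst p) * a (snd p)" and "s \<equiv> \<lambda>p. fst p + snd p"
  shows "complex_of_real (norm (\<Sum>n\<in>T. a n * e (n \<bullet> x)) ^ 4) =
    (\<Sum>p\<in>T \<times> T. \<Sum>q\<in>T \<times> T. c p * cnj (c q) * e (- (s q - s p) \<bullet> x))"
proof -
  define F where "F = (\<Sum>n\<in>T. a n * e (n \<bullet> x))"
  have F2: "F * F = (\<Sum>p\<in>T \<times> T. c p * e (s p \<bullet> x))"
    unfolding F_def sum_product sum.cartesian_product
    by (intro sum.cong) (auto simp: c_def s_def inner_add_left e_add)
  have "complex_of_real (norm F ^ 4) = (complex_of_real ((norm F)\<^sup>2))\<^sup>2" by simp
  also have "\<dots> = (F * F) * cnj (F * F)"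
    unfolding complex_norm_square by (simp add: power2_eq_square mult_ac)
  also have "\<dots> = (\<Sum>p\<in>T \<times> T. \<Sum>q\<in>T \<times> T. c p * cnj (c q) * e (- (s q - s p) \<bullet> x))"
  proof -
    have "e (s p \<bullet> x) * e (- (s q \<bullet> x)) = e (- (s q - s p) \<bullet> x)" for p q
      by (simp add: inner_diff_left flip: e_add)
    then show ?thesis
      unfolding F2 cnj_sum sum_product complex_cnj_mult cnj_e by (intro sum.cong) (auto simp: mult_ac)
  qed
  finally show ?thesis by (simp add: F_def)
qed

text \<open>The inequality \<open>2 * c p * c q \<le> (c p)^2 + (c q)^2\<close> splits the double
  sum into two halves, equal by symmetry of \<open>k\<close>; each is then summed along
  rows.\<close>

lemma schur_test:
  fixes c :: "'a \<Rightarrow> real" and k :: "'a \<Rightarrow> 'a \<Rightarrow> real"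
  assumes "\<And>p q. k p q = k q p" and "\<And>p q. k p q \<ge> 0"
    and "\<And>p. p \<in> A \<Longrightarrow> (\<Sum>q\<in>A. k p q) \<le> B"
  shows "(\<Sum>p\<in>A. \<Sum>q\<in>A. c p * c q * k p q) \<le> B * (\<Sum>p\<in>A. (c p)\<^sup>2)"
proof -
  have "c p * c q * k p q \<le> (c p)\<^sup>2 * k p q / 2 + (c q)\<^sup>2 * k p q / 2" for p q
  proof -
    have "2 * c p * c q \<le> (c p)\<^sup>2 + (c q)\<^sup>2" by (rule sum_squares_bound)
    then have "(2 * c p * c q) * k p q \<le> ((c p)\<^sup>2 + (c q)\<^sup>2) * k p q" using assms(2) by (rule mult_right_mono)
    then show ?thesis by (simp add: algebra_simps)
  qed
  then have "(\<Sum>p\<in>A. \<Sum>q\<in>A. c p * c q * k p q) \<le>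
      (\<Sum>p\<in>A. \<Sum>q\<in>A. (c p)\<^sup>2 * k p q / 2 + (c q)\<^sup>2 * k p q / 2)"
    by (intro sum_mono)
  also have "\<dots> = (\<Sum>p\<in>A. \<Sum>q\<in>A. (c p)\<^sup>2 * k p q / 2) + (\<Sum>p\<in>A. \<Sum>q\<in>A. (c q)\<^sup>2 * k p q / 2)"
    by (simp add: sum.distrib)
  also have "(\<Sum>p\<in>A. \<Sum>q\<in>A. (c q)\<^sup>2 * k p q / 2) = (\<Sum>p\<in>A. \<Sum>q\<in>A. (c p)\<^sup>2 * k p q / 2)"
    by (subst sum.swap, subst assms(1)) (rule refl)
  also have "(\<Sum>p\<in>A. \<Sum>q\<in>A. (c p)\<^sup>2 * k p q / 2) + (\<Sum>p\<in>A. \<Sum>q\<in>A. (c p)\<^sup>2 * k p q / 2)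
      = (\<Sum>p\<in>A. (c p)\<^sup>2 * (\<Sum>q\<in>A. k p q))"
    unfolding sum_distrib_left sum.distrib[symmetric] by (simp add: mult_ac)
  also have "\<dots> \<le> (\<Sum>p\<in>A. (c p)\<^sup>2 * B)"
    by (intro sum_mono mult_left_mono assms(3)) auto
  finally show ?thesis by (simp add: sum_distrib_left mult.commute)
qed

text \<open>Separates the measure from the arithmetic: what remains is to bound the row sums of a
  majorant \<open>k\<close> of the Fourier coefficients. Evenness of \<open>k\<close> makes the
  kernel symmetric for the Schur test.\<close>

lemma L4_le_of_row_sums:
  fixes \<sigma> :: "(real \<times> real) measure" and k :: "real \<times> real \<Rightarrow> real" and a :: "real \<times> real \<Rightarrow> complex"
  assumes \<sigma>: "finite_measure \<sigma>" "sets \<sigma> = sets torus2"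
    and k: "\<And>\<xi>. k \<xi> \<ge> 0" "\<And>\<xi>. k (- \<xi>) = k \<xi>"
    and le: "\<And>p q. p \<in> T \<times> T \<Longrightarrow> q \<in> T \<times> T \<Longrightarrow>
      norm (fourier_coeff \<sigma> ((fst p + snd p) - (fst q + snd q))) \<le> k ((fst p + snd p) - (fst q + snd q))"
    and row: "\<And>p. p \<in> T \<times> T \<Longrightarrow> (\<Sum>q\<in>T \<times> T. k ((fst p + snd p) - (fst q + snd q))) \<le> B"
  shows "(LINT x|\<sigma>. norm (\<Sum>n\<in>T. a n * e (n \<bullet> x)) ^ 4) \<le> B * L2_set (\<lambda>n. norm (a n)) T ^ 4"
proof -
  define c where "c = (\<lambda>p. a (fst p) * a (snd p))"
  define s :: "(real \<times> real) \<times> (real \<times> real) \<Rightarrow> real \<times> real" where "s = (\<lambda>p. fst p + snd p)"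
  define I where "I = (LINT x|\<sigma>. norm (\<Sum>n\<in>T. a n * e (n \<bullet> x)) ^ 4)"
  have int: "integrable \<sigma> (\<lambda>x. c p * cnj (c q) * e (- (s q - s p) \<bullet> x))" for p q
    by (intro integrable_mult_right integrable_character[OF \<sigma>])
  have "complex_of_real I = (LINT x|\<sigma>. complex_of_real (norm (\<Sum>n\<in>T. a n * e (n \<bullet> x)) ^ 4))"
    unfolding I_def by (rule integral_complex_of_real[symmetric])
  also have "\<dots> = (LINT x|\<sigma>. (\<Sum>p\<in>T \<times> T. \<Sum>q\<in>T \<times> T. c p * cnj (c q) * e (- (s q - s p) \<bullet> x)))"
    unfolding c_def s_def by (intro Bochner_Integration.integral_cong refl norm_trig_sum_power4)
  also have "\<dots> = (\<Sum>p\<in>T \<times> T. LINT x|\<sigma>. (\<Sum>q\<in>T \<times> T. c p * cnj (c q) * e (- (s q - s p) \<bullet> x)))"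
    by (intro Bochner_Integration.integral_sum Bochner_Integration.integrable_sum int)
  also have "\<dots> = (\<Sum>p\<in>T \<times> T. \<Sum>q\<in>T \<times> T. LINT x|\<sigma>. c p * cnj (c q) * e (- (s q - s p) \<bullet> x))"
    by (intro sum.cong refl Bochner_Integration.integral_sum int)
  also have "\<dots> = (\<Sum>p\<in>T \<times> T. \<Sum>q\<in>T \<times> T. c p * cnj (c q) * fourier_coeff \<sigma> (s q - s p))"
    by (simp add: fourier_coeff_def)
  finally have "I \<le> norm (\<Sum>p\<in>T \<times> T. \<Sum>q\<in>T \<times> T. c p * cnj (c q) * fourier_coeff \<sigma> (s q - s p))"
    by (metis norm_of_real abs_ge_self)
  also have "\<dots> \<le> (\<Sum>p\<in>T \<times> T. \<Sum>q\<in>T \<times> T. norm (c p) * norm (c q) * k (s q - s p))"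
    using le unfolding s_def[symmetric]
    by (intro sum_norm_le) (auto simp: norm_mult s_def intro!: sum_norm_le mult_left_mono)
  also have "\<dots> \<le> B * (\<Sum>p\<in>T \<times> T. (norm (c p))\<^sup>2)"
  proof (rule schur_test)
    show sym: "k (s q - s p) = k (s p - s q)" for p q using k(2)[of "s p - s q"] by simp
    show "(\<Sum>q\<in>T \<times> T. k (s q - s p)) \<le> B" if "p \<in> T \<times> T" for p
      unfolding sym[of _ p] using row[OF that] by (simp add: s_def)
  qed (rule k)
  \<comment> \<open>\<open>c\<close> is a product of two copies of \<open>a\<close>, so its squared
    norm over pairs factors.\<close>
  also have "(\<Sum>p\<in>T \<times> T. (norm (c p))\<^sup>2) = (\<Sum>n\<in>T. (norm (a n))\<^sup>2)\<^sup>2"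
    unfolding power2_eq_square[of "sum _ _"] sum_product sum.cartesian_product
    by (intro sum.cong) (auto simp: c_def norm_mult power_mult_distrib)
  also have "\<dots> = L2_set (\<lambda>n. norm (a n)) T ^ 4"
  proof -
    have "L2_set (\<lambda>n. norm (a n)) T ^ 4 = ((L2_set (\<lambda>n. norm (a n)) T)\<^sup>2)\<^sup>2" by simp
    also have "(L2_set (\<lambda>n. norm (a n)) T)\<^sup>2 = (\<Sum>n\<in>T. (norm (a n))\<^sup>2)"
      by (simp add: L2_set_def sum_nonneg)
    finally show ?thesis by simp
  qed
  finally show ?thesis by (simp add: I_def)
qed

subsection \<open>Uniform bound for the row sums\<close>

text \<open>The bound for the number of representations is quadratic in the divisor count, so the
  divisor bound is applied with \<open>\<epsilon> / 2\<close>.\<close>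

lemma card_S_bound:
  fixes \<epsilon> :: real
  assumes "\<epsilon> > 0"
  obtains C where "\<And>N. N > 0 \<Longrightarrow> real (card (S N)) \<le> C * real N powr \<epsilon>"
proof -
  obtain D where D: "\<And>n::nat. n > 0 \<Longrightarrow> real (card {d. d dvd n}) \<le> D * real n powr (\<epsilon> / 2)"
    using divisor_bound[of "\<epsilon> / 2"] assms by auto
  show ?thesis
  proof
    fix N :: nat assume "N > 0"
    have "card (S N) \<le> 15 * (card {d. d dvd N})\<^sup>2"
      using card_S_le card_sum_squares_reps_le[OF \<open>N > 0\<close>] by (rule order_trans)
    then have "real (card (S N)) \<le> real (15 * (card {d. d dvd N})\<^sup>2)" by (rule of_nat_mono)
    also have "\<dots> = 15 * (real (card {d. d dvd N}))\<^sup>2" by simp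
    also have "\<dots> \<le> 15 * (D * real N powr (\<epsilon> / 2))\<^sup>2"
      by (intro mult_left_mono power_mono D[OF \<open>N > 0\<close>]) auto
    also have "\<dots> = 15 * D\<^sup>2 * real N powr \<epsilon>"
      by (simp add: power_mult_distrib power2_eq_square flip: powr_add)
    finally show "real (card (S N)) \<le> 15 * D\<^sup>2 * real N powr \<epsilon>" .
  qed
qed

text \<open>Each component of such a \<open>q\<close> is within \<open>\<rho>\<close> of a component
  of \<open>p\<close>, so \<open>q\<close> lies in the square of a set with at most
  \<open>2 * B\<close> elements. Here 160 = 8 * 20: the 20 comes from the chord estimate, the 8 from
  the passage to arcs.\<close>

lemma card_near_pairs_le:
  fixes R L B :: real
  assumes "N > 0" and arcs: "\<And>A. is_arc N L A \<Longrightarrow> real (card (A \<inter> lattice2)) \<le> B"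
    and R: "0 < R" "R \<le> sqrt N" and L: "L \<le> sqrt N" "160 * sqrt (sqrt N * R) \<le> L"
    and p: "p \<in> S N \<times> S N"
  shows "real (card {q \<in> S N \<times> S N. norm ((fst p + snd p) - (fst q + snd q)) \<le> R}) \<le> (2 * B)\<^sup>2"
proof -
  obtain n\<^sub>1 n\<^sub>2 where n: "p = (n\<^sub>1, n\<^sub>2)" "n\<^sub>1 \<in> S N" "n\<^sub>2 \<in> S N" using p by auto
  define \<rho> where "\<rho> = 20 * sqrt (sqrt N * R)"
  define M where "M = (\<lambda>n. {m \<in> S N. norm (m - n) \<le> \<rho>})"
  have M: "finite (M n\<^sub>1 \<union> M n\<^sub>2)" using finite_S by (auto simp: M_def)
  have cardM: "real (card (M n)) \<le> B" if "n \<in> S N" for n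
    unfolding M_def using that L R
    by (intro card_close_points_le[OF \<open>N > 0\<close> arcs]) (auto simp: \<rho>_def S_def intro: order_trans[rotated])
  have "{q \<in> S N \<times> S N. norm ((fst p + snd p) - (fst q + snd q)) \<le> R} \<subseteq> (M n\<^sub>1 \<union> M n\<^sub>2) \<times> (M n\<^sub>1 \<union> M n\<^sub>2)"
  proof
    fix q assume q: "q \<in> {q \<in> S N \<times> S N. norm ((fst p + snd p) - (fst q + snd q)) \<le> R}"
    then obtain m\<^sub>1 m\<^sub>2 where m: "q = (m\<^sub>1, m\<^sub>2)" "m\<^sub>1 \<in> S N" "m\<^sub>2 \<in> S N"
      "norm ((n\<^sub>1 + n\<^sub>2) - (m\<^sub>1 + m\<^sub>2)) \<le> R" by (auto simp: n)
    have in1: "x \<in> M n\<^sub>1 \<union> M n\<^sub>2" if "x \<in> S N" "y \<in> S N" "norm ((n\<^sub>1 + n\<^sub>2) - (x + y)) \<le> R" for x y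
    proof -
      have "min (norm (x - n\<^sub>1)) (norm (x - n\<^sub>2)) \<le> \<rho>"
        unfolding \<rho>_def using that n R \<open>N > 0\<close>
        by (intro upper_semicircle_min_dist_le[where m\<^sub>2 = y]) (auto simp: S_def)
      then show ?thesis using that by (auto simp: M_def min_le_iff_disj)
    qed
    show "q \<in> (M n\<^sub>1 \<union> M n\<^sub>2) \<times> (M n\<^sub>1 \<union> M n\<^sub>2)"
      using in1[OF m(2,3,4)] in1[OF m(3,2)] m(4) by (simp add: m(1) add.commute)
  qed
  then have "card {q \<in> S N \<times> S N. norm ((fst p + snd p) - (fst q + snd q)) \<le> R}
      \<le> card ((M n\<^sub>1 \<union> M n\<^sub>2) \<times> (M n\<^sub>1 \<union> M n\<^sub>2))"
    using M by (intro card_mono) auto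
  then have "real (card {q \<in> S N \<times> S N. norm ((fst p + snd p) - (fst q + snd q)) \<le> R})
      \<le> (real (card (M n\<^sub>1 \<union> M n\<^sub>2)))\<^sup>2"
    by (simp add: card_cartesian_product power2_eq_square flip: of_nat_mult)
  also have "\<dots> \<le> (2 * B)\<^sup>2"
    using card_Un_le[of "M n\<^sub>1" "M n\<^sub>2"] cardM[OF n(2)] cardM[OF n(3)] by (intro power_mono) linarith+
  finally show ?thesis .
qed

lemma row_sum_le_near_plus_far:
  fixes f :: "'a \<Rightarrow> real" and \<beta> R :: real
  assumes "finite A" "\<beta> > 0" "R > 0" and "\<And>q. f q \<ge> 0"
  shows "(\<Sum>q\<in>A. (1 + f q) powr - \<beta>) \<le> card {q \<in> A. f q \<le> R} + card A * R powr - \<beta>"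
proof -
  have "(1 + f q) powr - \<beta> \<le> (if f q \<le> R then 1 else 0) + R powr - \<beta>" for q
  proof (cases "f q \<le> R")
    case True
    have "(1 + f q) powr - \<beta> \<le> 1 powr - \<beta>"
      using assms by (intro powr_mono2') auto
    then show ?thesis using True by (simp add: add_increasing2)
  next
    case False
    have "(1 + f q) powr - \<beta> \<le> R powr - \<beta>"
      using assms False by (intro powr_mono2') auto
    then show ?thesis using False by simp
  qed
  then have "(\<Sum>q\<in>A. (1 + f q) powr - \<beta>) \<le> (\<Sum>q\<in>A. (if f q \<le> R then 1 else 0) + R powr - \<beta>)"
    by (intro sum_mono)
  also have "\<dots> = card {q \<in> A. f q \<le> R} + card A * R powr - \<beta>"
    using assms(1) by (simp add: sum.distrib sum.If_cases Int_def)
  finally show ?thesis .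
qed

lemma row_sums_bounded:
  fixes \<gamma> \<beta> B :: real
  assumes \<gamma>: "1 / 2 < \<gamma>" "\<gamma> < 1" and "\<beta> > 0"
    and arcs: "\<And>N A. is_arc N (real N powr (\<gamma> / 2)) A \<Longrightarrow> real (card (A \<inter> lattice2)) \<le> B"
  shows "\<exists>C. \<forall>N. \<forall>p\<in>S N \<times> S N.
    (\<Sum>q\<in>S N \<times> S N. (1 + norm ((fst p + snd p) - (fst q + snd q))) powr - \<beta>) \<le> C"
proof -
  \<comment> \<open>The exponents balance:
    \<open>(1 / 2 + \<delta>) / 2 + \<delta> / 2 = \<gamma> / 2\<close>, which leaves a factor
    \<open>N powr (\<delta> / 2)\<close> to absorb the 160.\<close>
  define \<delta> where "\<delta> = (\<gamma> - 1 / 2) / 2"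
  have \<delta>: "0 < \<delta>" "\<delta> \<le> 1 / 2" using \<gamma> by (auto simp: \<delta>_def)
  \<comment> \<open>Squared, this is \<open>D^2 * N powr (\<delta> * \<beta>)\<close>, which
    \<open>R powr - \<beta>\<close> cancels exactly.\<close>
  obtain D where D: "\<And>N. N > 0 \<Longrightarrow> real (card (S N)) \<le> D * real N powr (\<delta> * \<beta> / 2)"
    using card_S_bound[of "\<delta> * \<beta> / 2"] \<delta> \<open>\<beta> > 0\<close> by auto
  \<comment> \<open>From here on \<open>N powr (\<delta> / 2) \<ge> 160\<close>. The finitely many
    smaller \<open>N\<close>, including 0, are covered by \<open>E\<close>, since each summand is at
    most 1.\<close>
  define N0 where "N0 = nat \<lceil>160 powr (2 / \<delta>)\<rceil>"
  define E where "E = (\<Sum>N<N0. (real (card (S N)))\<^sup>2)"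
  have E: "E \<ge> 0" by (simp add: E_def sum_nonneg)
  have "(\<Sum>q\<in>S N \<times> S N. (1 + norm ((fst p + snd p) - (fst q + snd q))) powr - \<beta>) \<le> E + ((2 * B)\<^sup>2 + D\<^sup>2)"
    if p: "p \<in> S N \<times> S N" for N p
  proof (cases "N < N0")
    case True
    have "(\<Sum>q\<in>S N \<times> S N. (1 + norm ((fst p + snd p) - (fst q + snd q))) powr - \<beta>) \<le> (\<Sum>q\<in>S N \<times> S N. 1)"
      using \<open>\<beta> > 0\<close> powr_mono2'[of "- \<beta>" 1] by (intro sum_mono) simp
    also have "\<dots> = (real (card (S N)))\<^sup>2" by (simp add: card_cartesian_product power2_eq_square)
    also have "\<dots> \<le> E" unfolding E_def using True by (intro member_le_sum) auto
    finally show ?thesis by (simp add: add_increasing2)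
  next
    case False
    then have N: "160 powr (2 / \<delta>) \<le> real N" by (simp add: N0_def nat_le_iff ceiling_le_iff not_less)
    then have "N > 0" by (cases "N = 0") auto
    then have N1: "real N \<ge> 1" by simp
    define R where "R = real N powr \<delta>"
    have R: "0 < R" "R \<le> sqrt N"
      using \<open>N > 0\<close> N1 \<delta> by (auto simp: R_def powr_half_sqrt[symmetric] intro: powr_mono)
    have L: "160 * sqrt (sqrt N * R) \<le> real N powr (\<gamma> / 2)"
    proof -
      have "sqrt (sqrt N * R) = real N powr ((1 / 2 + \<delta>) / 2)"
        by (simp add: R_def powr_powr flip: powr_half_sqrt powr_add)
      moreover have "160 \<le> real N powr (\<delta> / 2)"
      proof -
        have "160 = (160 powr (2 / \<delta>)) powr (\<delta> / 2)" using \<delta> by (simp add: powr_powr)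
        also have "\<dots> \<le> real N powr (\<delta> / 2)" using N \<delta> by (intro powr_mono2) auto
        finally show ?thesis .
      qed
      ultimately have "160 * sqrt (sqrt N * R) \<le> real N powr (\<delta> / 2) * real N powr ((1 / 2 + \<delta>) / 2)"
        by (simp add: mult_right_mono)
      also have "\<dots> = real N powr (\<gamma> / 2)"
        unfolding powr_add[symmetric] by (simp add: \<delta>_def field_simps)
      finally show ?thesis .
    qed
    \<comment> \<open>Here \<open>\<gamma> < 1\<close> enters: an arc of the assumed length is no
      longer than the radius and so fits into the semicircle.\<close>
    have "real N powr (\<gamma> / 2) \<le> sqrt N"
      using N1 \<gamma> by (auto simp: powr_half_sqrt[symmetric] intro: powr_mono)
    from card_near_pairs_le[OF \<open>N > 0\<close> arcs R this L p]
    have near: "real (card {q \<in> S N \<times> S N. norm ((fst p + snd p) - (fst q + snd q)) \<le> R}) \<le> (2 * B)\<^sup>2" .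
    have "real (card (S N \<times> S N)) * R powr - \<beta> = (real (card (S N)))\<^sup>2 * R powr - \<beta>"
      by (simp add: card_cartesian_product power2_eq_square)
    also have "\<dots> \<le> (D * real N powr (\<delta> * \<beta> / 2))\<^sup>2 * R powr - \<beta>"
      by (intro mult_right_mono power_mono D \<open>N > 0\<close>) auto
    also have "\<dots> = D\<^sup>2 * (real N powr (\<delta> * \<beta>) * real N powr - (\<delta> * \<beta>))"
      by (simp add: power_mult_distrib power2_eq_square R_def powr_powr flip: powr_add)
    also have "\<dots> = D\<^sup>2" using \<open>N > 0\<close> by (simp flip: powr_add)
    finally show ?thesis
      using row_sum_le_near_plus_far[OF finite_cartesian_product[OF finite_S finite_S] \<open>\<beta> > 0\<close> R(1),
          of "\<lambda>q. norm ((fst p + snd p) - (fst q + snd q))" N N] near E by simp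
  qed
  then show ?thesis by blast
qed

section \<open>From bounded row sums to the fourth moment\<close>

lemma lattice2_diff_sums:
  assumes "p \<in> lattice2 \<times> lattice2" "q \<in> lattice2 \<times> lattice2"
  shows "(fst p + snd p) - (fst q + snd q) \<in> lattice2"
  using assms by (auto simp: lattice2_def)

theorem theorem13p2:
  fixes \<gamma> \<beta> C\<^sub>\<gamma> :: real and \<sigma> :: "(real \<times> real) measure"
  assumes "1 / 2 < \<gamma>" and "\<gamma> < 1"
    and "\<And>(N::nat) A. is_arc N (real N powr (\<gamma> / 2)) A \<Longrightarrow> real (card (A \<inter> lattice2)) \<le> C\<^sub>\<gamma>"
    and "finite_measure \<sigma>" and "sets \<sigma> = sets torus2"
    and "\<beta> > 0"
    and "\<exists>K. \<forall>\<xi>\<in>lattice2. norm (fourier_coeff \<sigma> \<xi>) \<le> K * (1 + norm \<xi>) powr (- \<beta>)"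
  shows "\<exists>C. \<forall>(N::nat) (a :: real \<times> real \<Rightarrow> complex).
           (LINT x|\<sigma>. norm (\<Sum>n\<in>S N. a n * e (n \<bullet> x)) ^ 4)
             \<le> C * L2_set (\<lambda>n. norm (a n)) (S N) ^ 4"
proof -
  obtain K where K: "\<And>\<xi>. \<xi> \<in> lattice2 \<Longrightarrow> norm (fourier_coeff \<sigma> \<xi>) \<le> K * (1 + norm \<xi>) powr - \<beta>"
    using assms(7) by blast
  \<comment> \<open>At frequency 0 the weight is 1, so \<open>K\<close> itself bounds a norm; its
    sign makes the majorant nonnegative.\<close>
  have "0 \<in> lattice2" by (simp add: lattice2_def zero_prod_def)
  from K[OF this] have "K \<ge> 0" using order_trans[OF norm_ge_zero] by simp
  have "\<exists>C. \<forall>N. \<forall>p\<in>S N \<times> S N.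
      (\<Sum>q\<in>S N \<times> S N. (1 + norm ((fst p + snd p) - (fst q + snd q))) powr - \<beta>) \<le> C"
    using assms(1,2,6,3) by (rule row_sums_bounded)
  then obtain C where C: "\<And>N p. p \<in> S N \<times> S N \<Longrightarrow>
      (\<Sum>q\<in>S N \<times> S N. (1 + norm ((fst p + snd p) - (fst q + snd q))) powr - \<beta>) \<le> C"
    by blast
  show ?thesis
  proof (intro exI[of _ "K * C"] allI)
    fix N :: nat and a :: "real \<times> real \<Rightarrow> complex"
    show "(LINT x|\<sigma>. norm (\<Sum>n\<in>S N. a n * e (n \<bullet> x)) ^ 4) \<le> K * C * L2_set (\<lambda>n. norm (a n)) (S N) ^ 4"
    proof (rule L4_le_of_row_sums[OF assms(4,5), where k = "\<lambda>\<xi>. K * (1 + norm \<xi>) powr - \<beta>"])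
      show "0 \<le> K * (1 + norm \<xi>) powr - \<beta>" for \<xi> :: "real \<times> real" using \<open>K \<ge> 0\<close> by simp
      show "K * (1 + norm (- \<xi>)) powr - \<beta> = K * (1 + norm \<xi>) powr - \<beta>" for \<xi> :: "real \<times> real" by simp
      show "norm (fourier_coeff \<sigma> ((fst p + snd p) - (fst q + snd q)))
          \<le> K * (1 + norm ((fst p + snd p) - (fst q + snd q))) powr - \<beta>"
        if "p \<in> S N \<times> S N" "q \<in> S N \<times> S N" for p q
        using that by (intro K lattice2_diff_sums) (auto simp: S_def)
      show "(\<Sum>q\<in>S N \<times> S N. K * (1 + norm ((fst p + snd p) - (fst q + snd q))) powr - \<beta>) \<le> K * C"
        if "p \<in> S N \<times> S N" for p
        unfolding sum_distrib_left[symmetric] using C[OF that] \<open>K \<ge> 0\<close> by (rule mult_left_mono)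
    qed
  qed
qed

end
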